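(* Let $T>0$, $\bar\theta\in[0,1]$, and let $c,\psi$ satisfy the standing assumptions in the context. Suppose that for all $x,y\in[0,1]$ $$(x-y)[\psi(0,x)-\psi(0,y)]+(y-x)[\psi(1,x)-\psi(1,y)]\ge0,$$ and that there is $\gamma>0$ such that for all $p,q\in\mathbb{R}$ and all $\theta,\tilde\theta\in[0,1]$ $$\theta\big(h(q,\tilde\theta,0)-h(q,\theta,0)\big)+\tilde\theta\big(h(p,\theta,0)-h(p,\tilde\theta,0)\big)+(1-\theta)\big(h(-q,\tilde\theta,1)-h(-q,\theta,1)\big)+(1-\tilde\theta)\big(h(-p,\theta,1)-h(-p,\tilde\theta,1)\big)\le-\gamma|\theta-\tilde\theta|^2.$$ Then the initial-terminal value problem $$\begin{cases}\dfrac{d\theta}{dt}=(1-\theta)\,\alpha^*(u(0,t)-u(1,t),\theta,1)-\theta\,\alpha^*(u(1,t)-u(0,t),\theta,0),\qquad \theta(0)=\bar\theta,\\[2mm] -\dfrac{d}{dt}u(i,t)=h(u(1-i,t)-u(i,t),\theta(t),i),\qquad u(i,T)=\psi(i,\theta(T)),\quad i\in\{0,1\},\end{cases}$$ has a unique solution $(\theta,u)$, $\theta:[0,T]\to[0,1]$, $u:\{0,1\}\times[0,T]\to\mathbb{R}$.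
   Context: Standing assumptions on costs. $c:\{0,1\}\times[0,1]\times[0,\infty)\to\mathbb{R}$, $(i,\theta,\alpha)\mapsto c(i,\theta,\alpha)$, and $\psi:\{0,1\}\times[0,1]\to\mathbb{R}$ are non-negative and Lipschitz in $\theta$ (for each fixed value of the other variables). $c$ is differentiable in $\alpha$, with derivative $c'(i,\theta,\alpha)$ (one-sided at $\alpha=0$), and $c'$ is Lipschitz in $\theta$ with a constant independent of $(i,\alpha)$. $c$ is uniformly convex in $\alpha$: there is $\kappa>0$ with $c(i,\theta,\alpha')\ge c(i,\theta,\alpha)+c'(i,\theta,\alpha)(\alpha'-\alpha)+\kappa|\alpha'-\alpha|^2$ for all $i,\theta$ and $\alpha,\alpha'\ge0$; and $c$ is superlinear in $\alpha$ (i.e. $c(i,\theta,\alpha)/\alpha\to\infty$ as $\alpha\to\infty$). For $p\in\mathbb{R}$ put $h(p,\theta,i)=\min_{\alpha\ge0}[c(i,\theta,\alpha)+\alpha p]$ and let $\alpha^*(p,\theta,i)$ be the unique minimizer. *)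

theory Defs
  imports "HOL-Analysis.Analysis"
begin

(* The two states are the naturals 0 and 1; only the values of c, psi and u at these indices are
   used, and 1 - i is the other state.  Likewise c i th a is used only for th in [0,1], a >= 0. *)

(* For costs that are uniformly convex and continuous in the control, the minimum is attained at
   exactly one point, so Inf below is a minimum and the choice made by arg_min is unique. *)

definition hamiltonian ::
    "(nat \<Rightarrow> real \<Rightarrow> real \<Rightarrow> real) \<Rightarrow> real \<Rightarrow> real \<Rightarrow> nat \<Rightarrow> real" where
  "hamiltonian c p \<theta> i = (INF \<alpha>\<in>{0..}. c i \<theta> \<alpha> + \<alpha> * p)"

definition opt_control ::
    "(nat \<Rightarrow> real \<Rightarrow> real \<Rightarrow> real) \<Rightarrow> real \<Rightarrow> real \<Rightarrow> nat \<Rightarrow> real" where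
  "opt_control c p \<theta> i = arg_min (\<lambda>\<alpha>. c i \<theta> \<alpha> + \<alpha> * p) (\<lambda>\<alpha>. 0 \<le> \<alpha>)"

(* Classical solutions on [0,T]; the derivatives at 0 and T are one-sided. *)

definition mfg_solution ::
    "(nat \<Rightarrow> real \<Rightarrow> real \<Rightarrow> real) \<Rightarrow> (nat \<Rightarrow> real \<Rightarrow> real) \<Rightarrow> real \<Rightarrow> real
      \<Rightarrow> (real \<Rightarrow> real) \<Rightarrow> (nat \<Rightarrow> real \<Rightarrow> real) \<Rightarrow> bool" where
  "mfg_solution c \<psi> T \<theta>\<^sub>0 \<theta> u \<longleftrightarrow>
     (\<forall>t\<in>{0..T}. \<theta> t \<in> {0..1}) \<and>
     (\<forall>t\<in>{0..T}. (\<theta> has_real_derivative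
         ((1 - \<theta> t) * opt_control c (u 0 t - u 1 t) (\<theta> t) 1
           - \<theta> t * opt_control c (u 1 t - u 0 t) (\<theta> t) 0)) (at t within {0..T})) \<and>
     \<theta> 0 = \<theta>\<^sub>0 \<and>
     (\<forall>i\<in>{0, 1}. \<forall>t\<in>{0..T}. (u i has_real_derivative
         - hamiltonian c (u (1 - i) t - u i t) (\<theta> t) i) (at t within {0..T})) \<and>
     (\<forall>i\<in>{0, 1}. u i T = \<psi> i (\<theta> T))"

end

theory Submission
  imports Defs
begin

text \<open>With the value gap \<open>z = u 1 - u 0\<close> the system reduces to a planar two-point problem
  \<open>\<theta>' = F(\<theta>, z)\<close>, \<open>z' = G(\<theta>, z)\<close>, \<open>\<theta>(0) = \<theta>\<^sub>0\<close>, \<open>z(T) = \<Psi>(\<theta>(T))\<close>, where \<open>\<Psi> = \<psi> 1 - \<psi> 0\<close>.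
  Uniform convexity makes the minimizer, hence \<open>F\<close> and \<open>G\<close>, locally Lipschitz. After truncating
  \<open>F\<close> and \<open>G\<close> one shoots on the scalar \<open>z(0)\<close> by the intermediate value theorem. Since \<open>G\<close> is
  nondecreasing in \<open>z\<close>, \<open>|z|\<close> grows at most linearly backwards from \<open>T\<close>, so that the truncation is
  inactive. For uniqueness, the two monotonicity hypotheses force the duality pairing
  \<open>(\<theta> - \<theta>')(z' - z)\<close> of two solutions to vanish, which gives \<open>\<theta> = \<theta>'\<close>; then the monotonicity
  of \<open>G\<close> makes \<open>(z - z')\<^sup>2\<close> nondecreasing, and it vanishes at \<open>T\<close>.\<close>

section \<open>Sign and monotonicity arguments for functions with one-sided derivatives at the ends
  of an interval\<close>

lemma mono_of_deriv_within_nonneg: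
  fixes f f' :: "real \<Rightarrow> real"
  assumes "\<And>t. t \<in> {a..b} \<Longrightarrow> (f has_real_derivative f' t) (at t within {a..b})"
    and "\<And>t. t \<in> {a<..<b} \<Longrightarrow> f' t \<ge> 0" and "a \<le> b"
  shows "f a \<le> f b"
proof (cases "a = b")
  case False
  with assms obtain x where "x \<in> {a<..<b}" "f b - f a = f' x * (b - a)"
    using mvt_simple[of a b f "\<lambda>x h. f' x * h"] by (auto simp: has_field_derivative_def)
  with assms(2)[of x] \<open>a \<le> b\<close> show ?thesis
    by (smt (verit) mult_nonneg_nonneg)
qed simp

lemma deriv_within_zero_imp_zero:
  fixes f :: "real \<Rightarrow> real"
  assumes "\<And>t. t \<in> {0..T} \<Longrightarrow> (f has_real_derivative 0) (at t within {0..T})"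
    and "f T = 0" "t \<in> {0..T}"
  shows "f t = 0"
proof -
  obtain a where "\<And>t. t \<in> {0..T} \<Longrightarrow> f t = a"
    using has_field_derivative_zero_constant[of "{0..T}" f] assms(1) by auto
  with assms(2,3) show ?thesis by (metis atLeastAtMost_iff order_refl order_trans)
qed

text \<open>If \<open>g t > 0\<close>, let \<open>s\<close> be the last time before \<open>t\<close>
  with \<open>g s \<le> 0\<close>. On the open interval between them \<open>g\<close> is positive,
  hence nonincreasing, so \<open>g t \<le> g s\<close>, a contradiction. The sign condition concerns
  only the region \<open>g > 0\<close>, which is where truncated vector fields are easy to
  evaluate.\<close>

lemma nonpos_invariant_forward:
  fixes g g' :: "real \<Rightarrow> real"
  assumes deriv: "\<And>t. t \<in> {0..T} \<Longrightarrow> (g has_real_derivative g' t) (at t within {0..T})"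
    and "g 0 \<le> 0" and dec: "\<And>t. t \<in> {0..T} \<Longrightarrow> g t > 0 \<Longrightarrow> g' t \<le> 0"
    and t: "t \<in> {0..T}"
  shows "g t \<le> 0"
proof (rule ccontr)
  assume pos: "\<not> g t \<le> 0"
  define S where "S = {0..t} \<inter> g -` {..0}"
  have "continuous_on {0..T} g"
    using deriv DERIV_continuous by (fastforce simp: continuous_on_eq_continuous_within)
  hence "continuous_on {0..t} g"
    by (rule continuous_on_subset) (use t in auto)
  hence "closed S"
    unfolding S_def by (rule continuous_closed_preimage) auto
  hence "compact S"
    unfolding S_def by (metis compact_Icc compact_Int_closed inf_assoc inf.idem)
  moreover have "0 \<in> S"
    using assms by (auto simp: S_def)
  ultimately obtain s where s: "s \<in> S" and max: "\<And>r. r \<in> S \<Longrightarrow> r \<le> s"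
    using compact_attains_sup[of S] by blast
  have st: "0 \<le> s" "s \<le> t" "g s \<le> 0"
    using s by (auto simp: S_def)
  have "- g s \<le> - g t"
  proof (rule mono_of_deriv_within_nonneg[where f = "\<lambda>r. - g r" and f' = "\<lambda>r. - g' r"])
    fix r assume "r \<in> {s..t}"
    thus "((\<lambda>r. - g r) has_real_derivative - g' r) (at r within {s..t})"
      using deriv[of r] t st by (auto intro!: derivative_intros intro: DERIV_subset)
  next
    fix r assume r: "r \<in> {s<..<t}"
    hence "r \<notin> S"
      using max by fastforce
    hence "g r > 0"
      using r st by (auto simp: S_def)
    thus "- g' r \<ge> 0"
      using dec[of r] r st t by auto
  qed (use st in auto)
  with st pos show False by simp
qed

text \<open>Time reversal of the forward version, for barriers that start from terminal
  data.\<close>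

lemma nonpos_invariant_backward:
  fixes g g' :: "real \<Rightarrow> real"
  assumes deriv: "\<And>t. t \<in> {0..T} \<Longrightarrow> (g has_real_derivative g' t) (at t within {0..T})"
    and "g T \<le> 0" and inc: "\<And>t. t \<in> {0..T} \<Longrightarrow> g t > 0 \<Longrightarrow> g' t \<ge> 0"
    and t: "t \<in> {0..T}"
  shows "g t \<le> 0"
proof -
  have "g (T - (T - t)) \<le> 0"
  proof (rule nonpos_invariant_forward[where g = "\<lambda>s. g (T - s)" and g' = "\<lambda>s. - g' (T - s)"])
    fix s assume s: "s \<in> {0..T}"
    hence "(g has_real_derivative g' (T - s)) (at (T - s) within (\<lambda>s. T - s) ` {0..T})"
      by (intro DERIV_subset[OF deriv]) auto
    moreover have "((\<lambda>s. T - s) has_real_derivative - 1) (at s within {0..T})"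
      by (auto intro!: derivative_eq_intros)
    ultimately show "((\<lambda>s. g (T - s)) has_real_derivative - g' (T - s)) (at s within {0..T})"
      using DERIV_image_chain[of g _ "\<lambda>s. T - s"] by (force simp: o_def)
  qed (use assms in auto)
  thus ?thesis by simp
qed

section \<open>The flow of a globally Lipschitz vector field\<close>

text \<open>The Picard operator is a contraction in the norm weighted by \<open>exp (- l t)\<close>: the
  fixed point below is \<open>exp (- l t)\<close> times the solution.\<close>

lemma lipschitz_flow_exists:
  fixes f :: "'a::euclidean_space \<Rightarrow> 'a"
  assumes lip: "L-lipschitz_on UNIV f" and T: "T \<ge> 0"
  obtains \<Phi> where "\<And>x. \<Phi> x 0 = x"
    and "\<And>x t. t \<in> {0..T} \<Longrightarrow> (\<Phi> x has_vector_derivative f (\<Phi> x t)) (at t within {0..T})"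
    and "\<And>t. t \<in> {0..T} \<Longrightarrow> continuous_on UNIV (\<lambda>x. \<Phi> x t)"
proof -
  \<comment> \<open>The weight is chosen so that the contraction factor \<open>L / l\<close> is at
    most 1/2; the summand 1 keeps \<open>l\<close> positive when \<open>L = 0\<close>.\<close>
  define l where "l = 2 * L + 1"
  have L: "L \<ge> 0" and l: "l > 0" "L / l \<le> 1 / 2"
    using lipschitz_on_nonneg[OF lip] by (auto simp: l_def field_simps)
  have cont_f: "continuous_on UNIV f"
    using lip by (rule lipschitz_on_continuous_on)
  define R where "R u s = f (exp (l * s) *\<^sub>R apply_bcontfun u s)" for u :: "real \<Rightarrow>\<^sub>C 'a" and s
  have R: "continuous_on A (R u)" for u A
    unfolding R_def by (intro continuous_on_compose2[OF cont_f] continuous_intros) auto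
  define I where "I x u t = x + integral {0..t} (R u)" for x u t
  have I: "(I x u has_vector_derivative R u t) (at t within {0..T})" if "t \<in> {0..T}" for x u t
    unfolding I_def using integral_has_vector_derivative[OF R that, of u]
    by (auto intro!: derivative_eq_intros)
  have cont_I: "continuous_on {0..T} (I x u)" for x u
    unfolding I_def by (intro continuous_intros indefinite_integral_continuous_1
        integrable_continuous_real R)
  define Q where "Q x u t = exp (- l * t) *\<^sub>R I x u t" for x u t
  have cont_Q: "continuous_on (cbox 0 T) (Q x u)" for x u
    unfolding Q_def by (intro continuous_intros) (use cont_I in auto)
  \<comment> \<open>Clamping the time extends the Picard image constantly beyond [0,T]. This makes
    it a bounded continuous function on the whole line, an element of the complete space in which
    the fixed point is sought.\<close>
  define P where "P x u = Bcontfun (\<lambda>t. Q x u (clamp 0 T t))" for x u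
  have P: "apply_bcontfun (P x u) t = Q x u (clamp 0 T t)" for x u t
  proof -
    have "bounded (Q x u ` cbox 0 T)"
      using cont_Q by (intro compact_imp_bounded compact_continuous_image) auto
    hence "bounded (range (\<lambda>t. Q x u (clamp 0 T t)))"
      by (rule clamp_bounded)
    thus ?thesis
      unfolding P_def using clamp_continuous_on[OF cont_Q]
      by (subst Bcontfun_inverse) (auto simp: bcontfun_def)
  qed
  \<comment> \<open>One estimate serves twice: for \<open>x = y\<close> it is the contraction
    property, and between two fixed points it gives Lipschitz dependence on the initial
    value.\<close>
  have P_dist: "dist (P x u) (P y v) \<le> dist x y + 1 / 2 * dist u v" for x y u v
  proof (rule dist_bound)
    fix r
    define t where "t = clamp 0 T r"
    have t: "t \<in> {0..T}"
      unfolding t_def using clamp_in_interval[of 0 T r] T by (simp add: box_real)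
    \<comment> \<open>The factor \<open>exp (l * s)\<close> undoes the rescaling inside
      \<open>R\<close>. Its integral contributes the gain \<open>1 / l\<close>, and the growth
      \<open>exp (l * t)\<close> is cancelled by the weight in \<open>Q\<close>.\<close>
    have E: "((\<lambda>s. L * exp (l * s) * dist u v) has_integral
        (L / l * exp (l * t) * dist u v - L / l * exp (l * 0) * dist u v)) {0..t}"
      using t l by (intro fundamental_theorem_of_calculus)
        (auto simp: has_real_derivative_iff_has_vector_derivative[symmetric]
          intro!: derivative_eq_intros)
    have "norm (integral {0..t} (R u) - integral {0..t} (R v))
        = norm (integral {0..t} (\<lambda>s. R u s - R v s))"
      by (subst Henstock_Kurzweil_Integration.integral_diff)
        (auto intro!: integrable_continuous_real R)
    also have "\<dots> \<le> integral {0..t} (\<lambda>s. L * exp (l * s) * dist u v)"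
    proof (rule Henstock_Kurzweil_Integration.integral_norm_bound_integral)
      fix s
      have "norm (R u s - R v s)
          \<le> L * dist (exp (l * s) *\<^sub>R apply_bcontfun u s) (exp (l * s) *\<^sub>R apply_bcontfun v s)"
        using lipschitz_onD[OF lip] by (simp add: R_def dist_norm)
      also have "\<dots> = L * (exp (l * s) * dist (apply_bcontfun u s) (apply_bcontfun v s))"
        by (simp add: dist_norm flip: scaleR_diff_right)
      also have "\<dots> \<le> L * (exp (l * s) * dist u v)"
        using L by (intro mult_left_mono dist_bounded) auto
      finally show "norm (R u s - R v s) \<le> L * exp (l * s) * dist u v"
        by (simp add: mult.assoc)
    qed (auto intro!: integrable_continuous_real continuous_intros R)
    also have "\<dots> \<le> L / l * exp (l * t) * dist u v"
      unfolding integral_unique[OF E] using L l by simp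
    also have "\<dots> \<le> 1 / 2 * exp (l * t) * dist u v"
      using l by (intro mult_right_mono) auto
    finally have "norm (I x u t - I y v t) \<le> dist x y + 1 / 2 * exp (l * t) * dist u v"
      unfolding I_def dist_norm
      by (smt (verit) norm_triangle_ineq add_diff_add)
    hence "exp (- l * t) * norm (I x u t - I y v t)
        \<le> exp (- l * t) * (dist x y + 1 / 2 * exp (l * t) * dist u v)"
      by (intro mult_left_mono) auto
    also have "\<dots> = exp (- l * t) * dist x y + 1 / 2 * dist u v"
      by (simp add: exp_minus field_simps)
    also have "\<dots> \<le> dist x y + 1 / 2 * dist u v"
      using l t by (auto intro!: mult_left_le_one_le)
    finally show "dist (P x u r) (P y v r) \<le> dist x y + 1 / 2 * dist u v"
      by (simp add: P Q_def dist_norm flip: t_def scaleR_diff_right)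
  qed
  have "\<exists>!u. P x u = u" for x
    using P_dist[of x _ x] by (intro banach_fix_type[of "1 / 2"]) auto
  then obtain Y where Y: "P x (Y x) = Y x" for x
    by metis
  \<comment> \<open>The term \<open>1 / 2 * dist (Y x) (Y y)\<close> is absorbed on the
    left.\<close>
  have Y_dist: "dist (Y x) (Y y) \<le> 2 * dist x y" for x y
    using P_dist[of x "Y x" y "Y y"] by (simp add: Y)
  have Y_eq: "exp (l * t) *\<^sub>R Y x t = I x (Y x) t" if "t \<in> {0..T}" for x t
    using P[of x "Y x" t] that by (simp add: Y Q_def box_real flip: exp_add)
  define \<Phi> where "\<Phi> x t = exp (l * t) *\<^sub>R Y x t" for x t
  show thesis
  proof
    show "\<Phi> x 0 = x" for x
      using Y_eq[of 0 x] T by (simp add: \<Phi>_def I_def)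
    show "(\<Phi> x has_vector_derivative f (\<Phi> x t)) (at t within {0..T})" if "t \<in> {0..T}" for x t
      using I[OF that, of x "Y x"] that unfolding R_def \<Phi>_def
      by (rule has_vector_derivative_transform[rotated 2]) (auto simp: Y_eq)
    show "continuous_on UNIV (\<lambda>x. \<Phi> x t)" for t
    proof (rule lipschitz_on_continuous_on)
      show "(exp (l * t) * 2)-lipschitz_on UNIV (\<lambda>x. \<Phi> x t)"
      proof (rule lipschitz_onI)
        fix x y
        have "dist (\<Phi> x t) (\<Phi> y t) = exp (l * t) * dist (Y x t) (Y y t)"
          by (simp add: \<Phi>_def dist_norm flip: scaleR_diff_right)
        also have "\<dots> \<le> exp (l * t) * (2 * dist x y)"
          using order_trans[OF dist_bounded Y_dist] by (intro mult_left_mono) auto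
        finally show "dist (\<Phi> x t) (\<Phi> y t) \<le> exp (l * t) * 2 * dist x y"
          by simp
      qed simp
    qed
  qed
qed

section \<open>Minimization of uniformly convex functions on the half-line\<close>

text \<open>Convexity based at 0 confines the minimization to a compact interval. Quadratic growth
  around the minimizer comes from a midpoint comparison, which also covers a minimizer on the
  boundary without a first-order condition.\<close>

lemma uniformly_convex_minimizer:
  fixes f f' :: "real \<Rightarrow> real"
  assumes "\<kappa> > 0" and cont: "continuous_on {0..} f"
    and conv: "\<And>a b. a \<ge> 0 \<Longrightarrow> b \<ge> 0 \<Longrightarrow> f b \<ge> f a + f' a * (b - a) + \<kappa> * (b - a)\<^sup>2"
  obtains a where "a \<ge> 0" "\<And>b. b \<ge> 0 \<Longrightarrow> f b \<ge> f a + \<kappa> / 2 * (b - a)\<^sup>2"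
proof -
  \<comment> \<open>Beyond \<open>r\<close> the quadratic term \<open>\<kappa> * b\<^sup>2\<close>
    outweighs the linear term \<open>f' 0 * b\<close>.\<close>
  define r where "r = \<bar>f' 0\<bar> / \<kappa>"
  have "r \<ge> 0"
    using \<open>\<kappa> > 0\<close> by (simp add: r_def)
  moreover have "continuous_on {0..r} f"
    by (rule continuous_on_subset[OF cont]) auto
  ultimately obtain a where a: "a \<in> {0..r}" and min: "\<And>b. b \<in> {0..r} \<Longrightarrow> f a \<le> f b"
    using continuous_attains_inf[of "{0..r}" f] by auto
  have min': "f a \<le> f b" if "b \<ge> 0" for b
  proof (cases "b \<le> r")
    case False
    hence "\<bar>f' 0\<bar> \<le> \<kappa> * b"
      using \<open>\<kappa> > 0\<close> by (simp add: r_def field_simps)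
    hence "0 \<le> b * (f' 0 + \<kappa> * b)"
      using that by (intro mult_nonneg_nonneg) auto
    also have "\<dots> \<le> f b - f 0"
      using conv[of 0 b] that by (simp add: algebra_simps power2_eq_square)
    finally show ?thesis
      using min[of 0] \<open>r \<ge> 0\<close> by simp
  qed (use min that in auto)
  show thesis
  proof
    show "a \<ge> 0" using a by simp
    fix b :: real assume b: "b \<ge> 0"
    define m where "m = (a + b) / 2"
    have m: "m \<ge> 0"
      using a b by (simp add: m_def)
    \<comment> \<open>The convexity inequalities based at the midpoint are added: the slope terms
      cancel, and the two squares of half the distance sum to
      \<open>\<kappa> / 2 * (b - a)\<^sup>2\<close>.\<close>
    have "f a + f b \<ge> 2 * f m + \<kappa> / 2 * (b - a)\<^sup>2"
      using conv[OF m b] conv[OF m \<open>a \<ge> 0\<close>]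
      by (simp add: m_def power2_eq_square field_simps)
    with min'[OF m] show "f b \<ge> f a + \<kappa> / 2 * (b - a)\<^sup>2"
      by simp
  qed
qed

section \<open>Regularity of the optimal control and of the Hamiltonian\<close>

text \<open>The cost itself is taken Lipschitz in theta at control 0 only: combined with the uniform
  constant \<open>L\<close> for \<open>c'\<close>, this yields at control \<open>b\<close> the
  constant \<open>L\<^sub>0 + L * b\<close>, whose growth in \<open>b\<close> is explicit.\<close>

locale two_state_cost =
  fixes c c' :: "nat \<Rightarrow> real \<Rightarrow> real \<Rightarrow> real" and \<kappa> L L\<^sub>0 :: real
  assumes kappa_pos: "\<kappa> > 0"
    and c_deriv: "\<And>i \<theta> \<alpha>. i \<in> {0, 1} \<Longrightarrow> \<theta> \<in> {0..1} \<Longrightarrow> \<alpha> \<ge> 0 \<Longrightarrow>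
        (c i \<theta> has_real_derivative c' i \<theta> \<alpha>) (at \<alpha> within {0..})"
    and c_unif_convex: "\<And>i \<theta> \<alpha> \<alpha>'. i \<in> {0, 1} \<Longrightarrow> \<theta> \<in> {0..1} \<Longrightarrow> \<alpha> \<ge> 0 \<Longrightarrow> \<alpha>' \<ge> 0 \<Longrightarrow>
        c i \<theta> \<alpha>' \<ge> c i \<theta> \<alpha> + c' i \<theta> \<alpha> * (\<alpha>' - \<alpha>) + \<kappa> * \<bar>\<alpha>' - \<alpha>\<bar>\<^sup>2"
    and c'_lipschitz: "\<And>i \<alpha>. i \<in> {0, 1} \<Longrightarrow> \<alpha> \<ge> 0 \<Longrightarrow> L-lipschitz_on {0..1} (\<lambda>\<theta>. c' i \<theta> \<alpha>)"
    and c_lipschitz: "\<And>i. i \<in> {0, 1} \<Longrightarrow> L\<^sub>0-lipschitz_on {0..1} (\<lambda>\<theta>. c i \<theta> 0)"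
begin

lemma L_nonneg: "L \<ge> 0" "L\<^sub>0 \<ge> 0"
  using c'_lipschitz[of 0 0] c_lipschitz[of 0] by (auto dest: lipschitz_on_nonneg)

abbreviation "ctrl \<equiv> opt_control c"
abbreviation "h \<equiv> hamiltonian c"

text \<open>Quadratic growth rules out a second minimizer, which pins down the choice made by
  \<open>arg_min\<close>. Nonnegativity and growth are all that is used about the control
  afterwards.\<close>

lemma opt_control:
  assumes "i \<in> {0, 1}" "\<theta> \<in> {0..1}"
  shows opt_control_nonneg: "ctrl p \<theta> i \<ge> 0"
    and opt_control_growth: "b \<ge> 0 \<Longrightarrow>
      c i \<theta> b + b * p \<ge> c i \<theta> (ctrl p \<theta> i) + ctrl p \<theta> i * p + \<kappa> / 2 * (b - ctrl p \<theta> i)\<^sup>2"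
proof -
  define f where "f b = c i \<theta> b + b * p" for b
  have "continuous_on {0..} (c i \<theta>)"
    using c_deriv[OF assms] DERIV_continuous by (fastforce simp: continuous_on_eq_continuous_within)
  hence "continuous_on {0..} f"
    unfolding f_def by (intro continuous_intros)
  moreover have "f b \<ge> f a + (c' i \<theta> a + p) * (b - a) + \<kappa> * (b - a)\<^sup>2" if "a \<ge> 0" "b \<ge> 0" for a b
    using c_unif_convex[OF assms that] by (simp add: f_def algebra_simps)
  ultimately obtain a where a: "a \<ge> 0" "\<And>b. b \<ge> 0 \<Longrightarrow> f b \<ge> f a + \<kappa> / 2 * (b - a)\<^sup>2"
    using uniformly_convex_minimizer[OF kappa_pos, of f "\<lambda>a. c' i \<theta> a + p"] by blast
  have min: "f b \<ge> f a" if "b \<ge> 0" for b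
    using a(2)[OF that] kappa_pos by (smt (verit) zero_le_power2 divide_pos_pos mult_nonneg_nonneg)
  have "arg_min f (\<lambda>b. 0 \<le> b) = a"
  proof (rule arg_minI)
    fix x assume x: "0 \<le> x" "\<forall>y\<ge>0. \<not> f y < f x"
    hence "\<kappa> / 2 * (x - a)\<^sup>2 \<le> 0"
      using a(2)[of x] a(1) by fastforce
    thus "x = a"
      using kappa_pos by (simp add: mult_le_0_iff)
  qed (use a(1) min in \<open>auto simp: not_less\<close>)
  hence [simp]: "ctrl p \<theta> i = a"
    by (simp add: opt_control_def f_def[abs_def])
  show "ctrl p \<theta> i \<ge> 0"
    "b \<ge> 0 \<Longrightarrow> c i \<theta> b + b * p \<ge> c i \<theta> (ctrl p \<theta> i) + ctrl p \<theta> i * p + \<kappa> / 2 * (b - ctrl p \<theta> i)\<^sup>2"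
    using a by (auto simp: f_def)
qed

lemma hamiltonian_eq:
  assumes "i \<in> {0, 1}" "\<theta> \<in> {0..1}"
  shows "h p \<theta> i = c i \<theta> (ctrl p \<theta> i) + ctrl p \<theta> i * p"
  unfolding hamiltonian_def
proof (rule cInf_eq_minimum)
  show "c i \<theta> (ctrl p \<theta> i) + ctrl p \<theta> i * p \<in> (\<lambda>\<alpha>. c i \<theta> \<alpha> + \<alpha> * p) ` {0..}"
    using opt_control_nonneg[OF assms] by auto
next
  fix x assume "x \<in> (\<lambda>\<alpha>. c i \<theta> \<alpha> + \<alpha> * p) ` {0..}"
  then obtain b where b: "b \<ge> 0" "x = c i \<theta> b + b * p"
    by auto
  have "0 \<le> \<kappa> / 2 * (b - ctrl p \<theta> i)\<^sup>2"
    using kappa_pos by simp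
  thus "c i \<theta> (ctrl p \<theta> i) + ctrl p \<theta> i * p \<le> x"
    using opt_control_growth[OF assms b(1), of p] b(2) by linarith
qed

lemma hamiltonian_le:
  assumes "i \<in> {0, 1}" "\<theta> \<in> {0..1}" "b \<ge> 0"
  shows "h p \<theta> i \<le> c i \<theta> b + b * p"
proof -
  have "0 \<le> \<kappa> / 2 * (b - ctrl p \<theta> i)\<^sup>2"
    using kappa_pos by simp
  thus ?thesis
    using opt_control_growth[OF assms, of p] hamiltonian_eq[OF assms(1,2), of p] by linarith
qed

text \<open>The control optimal for \<open>p\<close> is admissible for \<open>q\<close>, so it is a
  supergradient of the Hamiltonian at \<open>p\<close>. This replaces the envelope formula and
  requires no derivative of the Hamiltonian.\<close>

lemma hamiltonian_concave:
  assumes "i \<in> {0, 1}" "\<theta> \<in> {0..1}"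
  shows "h q \<theta> i \<le> h p \<theta> i + ctrl p \<theta> i * (q - p)"
  using hamiltonian_le[OF assms opt_control_nonneg[OF assms, of p], of q] hamiltonian_eq[OF assms, of p]
  by (simp add: algebra_simps)

lemma hamiltonian_mono:
  assumes "i \<in> {0, 1}" "\<theta> \<in> {0..1}" "p \<le> q"
  shows "h p \<theta> i \<le> h q \<theta> i"
proof -
  have "0 \<le> ctrl q \<theta> i * (q - p)"
    using opt_control_nonneg[OF assms(1,2), of q] assms(3) by simp
  thus ?thesis
    using hamiltonian_concave[OF assms(1,2), of p q] by (simp add: algebra_simps)
qed

text \<open>Mean value inequality in the control for the difference of the costs at two values of
  theta; its derivative is a difference of \<open>c'\<close>, bounded through
  \<open>L\<close>.\<close>

lemma cost_difference:
  assumes "i \<in> {0, 1}" "\<theta> \<in> {0..1}" "\<eta> \<in> {0..1}" "a \<ge> 0" "b \<ge> 0"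
  shows "\<bar>(c i \<theta> b - c i \<eta> b) - (c i \<theta> a - c i \<eta> a)\<bar> \<le> L * \<bar>\<theta> - \<eta>\<bar> * \<bar>b - a\<bar>"
proof -
  have "norm ((c i \<theta> b - c i \<eta> b) - (c i \<theta> a - c i \<eta> a)) \<le> L * \<bar>\<theta> - \<eta>\<bar> * norm (b - a)"
  proof (rule field_differentiable_bound)
    fix x :: real assume x: "x \<in> {0..}"
    show "((\<lambda>x. c i \<theta> x - c i \<eta> x) has_real_derivative c' i \<theta> x - c' i \<eta> x) (at x within {0..})"
      using x assms by (intro derivative_intros c_deriv) auto
    show "norm (c' i \<theta> x - c' i \<eta> x) \<le> L * \<bar>\<theta> - \<eta>\<bar>"
      using lipschitz_onD[OF c'_lipschitz, of i x \<theta> \<eta>] x assms by (simp add: dist_real_def)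
  qed (use assms in auto)
  thus ?thesis by simp
qed

lemma cost_lipschitz:
  assumes "i \<in> {0, 1}" "\<theta> \<in> {0..1}" "\<eta> \<in> {0..1}" "b \<ge> 0"
  shows "\<bar>c i \<theta> b - c i \<eta> b\<bar> \<le> (L\<^sub>0 + L * b) * \<bar>\<theta> - \<eta>\<bar>"
  using cost_difference[OF assms(1-3) order_refl assms(4)]
    lipschitz_onD[OF c_lipschitz assms(2,3), of i] assms(1,4)
  by (simp add: dist_real_def algebra_simps)

text \<open>Each minimizer is tested in the growth inequality of the other and the results are
  added. The left side becomes \<open>\<kappa> * (b - a)\<^sup>2\<close>, while
  \<open>cost_difference\<close> makes the right side linear in \<open>\<bar>b - a\<bar>\<close>;
  one factor is then divided out.\<close>

lemma opt_control_lipschitz: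
  assumes i: "i \<in> {0, 1}" and "\<theta> \<in> {0..1}" "\<eta> \<in> {0..1}"
  shows "\<bar>ctrl p \<theta> i - ctrl q \<eta> i\<bar> \<le> (L * \<bar>\<theta> - \<eta>\<bar> + \<bar>p - q\<bar>) / \<kappa>"
proof -
  define a where "a = ctrl p \<theta> i"
  define b where "b = ctrl q \<eta> i"
  have ab: "a \<ge> 0" "b \<ge> 0"
    using assms opt_control_nonneg by (auto simp: a_def b_def)
  have "\<kappa> * (b - a)\<^sup>2 \<le> (c i \<theta> b - c i \<eta> b) - (c i \<theta> a - c i \<eta> a) + (p - q) * (b - a)"
    using opt_control_growth[OF i assms(2) ab(2), of p] opt_control_growth[OF i assms(3) ab(1), of q]
    by (simp add: algebra_simps power2_commute[of a b] flip: a_def b_def)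
  also have "\<dots> \<le> L * \<bar>\<theta> - \<eta>\<bar> * \<bar>b - a\<bar> + \<bar>p - q\<bar> * \<bar>b - a\<bar>"
    using cost_difference[OF assms ab] abs_ge_self[of "(p - q) * (b - a)"]
    unfolding abs_mult[of "p - q"] by linarith
  finally have "\<kappa> * \<bar>b - a\<bar> * \<bar>b - a\<bar> \<le> (L * \<bar>\<theta> - \<eta>\<bar> + \<bar>p - q\<bar>) * \<bar>b - a\<bar>"
    by (simp add: power2_eq_square algebra_simps)
  hence "\<kappa> * \<bar>b - a\<bar> \<le> L * \<bar>\<theta> - \<eta>\<bar> + \<bar>p - q\<bar>"
    using L_nonneg by (cases "b = a") (auto simp: mult_le_cancel_right)
  thus ?thesis
    using kappa_pos by (simp add: field_simps abs_minus_commute flip: a_def b_def)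
qed

text \<open>The optimal control of either problem competes in the other, so the Lipschitz constant
  in \<open>p\<close> is the size of the control. This is why a bound \<open>A\<close> on the
  controls enters.\<close>

lemma hamiltonian_lipschitz:
  assumes i: "i \<in> {0, 1}" and "\<theta> \<in> {0..1}" "\<eta> \<in> {0..1}"
    and A: "ctrl p \<theta> i \<le> A" "ctrl q \<eta> i \<le> A"
  shows "\<bar>h p \<theta> i - h q \<eta> i\<bar> \<le> (L\<^sub>0 + L * A) * \<bar>\<theta> - \<eta>\<bar> + A * \<bar>p - q\<bar>"
proof -
  have *: "h p \<theta> i - h q \<eta> i \<le> (L\<^sub>0 + L * A) * \<bar>\<theta> - \<eta>\<bar> + A * \<bar>p - q\<bar>"
    if "\<theta> \<in> {0..1}" "\<eta> \<in> {0..1}" "ctrl q \<eta> i \<le> A" for p q \<theta> \<eta>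
  proof -
    define b where "b = ctrl q \<eta> i"
    have b: "0 \<le> b" "b \<le> A"
      using opt_control_nonneg[OF i] that by (auto simp: b_def)
    have "h p \<theta> i - h q \<eta> i \<le> (c i \<theta> b - c i \<eta> b) + b * (p - q)"
      using hamiltonian_le[OF i that(1) b(1), of p] hamiltonian_eq[OF i that(2), of q]
      by (simp add: algebra_simps flip: b_def)
    also have "\<dots> \<le> (L\<^sub>0 + L * b) * \<bar>\<theta> - \<eta>\<bar> + b * \<bar>p - q\<bar>"
      using cost_lipschitz[OF i that(1,2) b(1)] b(1) by (intro add_mono mult_left_mono) auto
    also have "\<dots> \<le> (L\<^sub>0 + L * A) * \<bar>\<theta> - \<eta>\<bar> + A * \<bar>p - q\<bar>"
      using b L_nonneg by (intro add_mono mult_right_mono mult_left_mono) auto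
    finally show ?thesis .
  qed
  show ?thesis
    using *[of \<theta> \<eta> q p] *[of \<eta> \<theta> p q] assms by (auto simp: abs_minus_commute abs_le_iff)
qed

section \<open>The planar system for the distribution and the value gap\<close>

text \<open>Net flow into state 0, whose mass is theta, with \<open>z\<close> standing for
  \<open>u 1 - u 0\<close>.\<close>

definition flux :: "real \<Rightarrow> real \<Rightarrow> real" where
  "flux \<theta> z = (1 - \<theta>) * ctrl (- z) \<theta> 1 - \<theta> * ctrl z \<theta> 0"

text \<open>The time derivative of \<open>u 1 - u 0\<close>; the minus sign in the equations for
  \<open>u\<close> puts state 0 first.\<close>

definition gap_rate :: "real \<Rightarrow> real \<Rightarrow> real" where
  "gap_rate \<theta> z = h z \<theta> 0 - h (- z) \<theta> 1"

text \<open>This monotonicity, a consequence of nonnegative controls, drives both the a priori bound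
  on the gap and its uniqueness.\<close>

lemma gap_rate_mono: "\<theta> \<in> {0..1} \<Longrightarrow> z \<le> w \<Longrightarrow> gap_rate \<theta> z \<le> gap_rate \<theta> w"
  using hamiltonian_mono[of 0 \<theta> z w] hamiltonian_mono[of 1 \<theta> "- w" "- z"]
  by (simp add: gap_rate_def)

text \<open>For gaps bounded by \<open>M\<close> the controls are uniformly bounded, and the
  estimates for control and Hamiltonian then hold with one common constant.\<close>

lemma locally_lipschitz:
  obtains K where "K \<ge> 0"
    and "\<And>\<theta> \<eta> z w. \<theta> \<in> {0..1} \<Longrightarrow> \<eta> \<in> {0..1} \<Longrightarrow> \<bar>z\<bar> \<le> M \<Longrightarrow> \<bar>w\<bar> \<le> M \<Longrightarrow>
      \<bar>flux \<theta> z - flux \<eta> w\<bar> \<le> K * (\<bar>\<theta> - \<eta>\<bar> + \<bar>z - w\<bar>)"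
    and "\<And>i \<theta> \<eta> z w. i \<in> {0, 1} \<Longrightarrow> \<theta> \<in> {0..1} \<Longrightarrow> \<eta> \<in> {0..1} \<Longrightarrow> \<bar>z\<bar> \<le> M \<Longrightarrow> \<bar>w\<bar> \<le> M \<Longrightarrow>
      \<bar>h z \<theta> i - h w \<eta> i\<bar> \<le> K * (\<bar>\<theta> - \<eta>\<bar> + \<bar>z - w\<bar>)"
    and "\<And>\<theta> \<eta> z w. \<theta> \<in> {0..1} \<Longrightarrow> \<eta> \<in> {0..1} \<Longrightarrow> \<bar>z\<bar> \<le> M \<Longrightarrow> \<bar>w\<bar> \<le> M \<Longrightarrow>
      \<bar>gap_rate \<theta> z - gap_rate \<eta> w\<bar> \<le> K * (\<bar>\<theta> - \<eta>\<bar> + \<bar>z - w\<bar>)"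
proof -
  \<comment> \<open>Bound on all controls by comparison with \<open>p = 0\<close> and
    \<open>\<theta> = 0\<close>. The nonnegative reference values are summed to cover both states,
    and \<open>\<bar>M\<bar>\<close> keeps \<open>A\<close> nonnegative for every
    \<open>M\<close>.\<close>
  define A where "A = ctrl 0 0 0 + ctrl 0 0 1 + (L + \<bar>M\<bar>) / \<kappa>"
  \<comment> \<open>The factor 2 accounts for the two controls in \<open>flux\<close> and the two
    Hamiltonians in \<open>gap_rate\<close>; a single Hamiltonian has constant
    \<open>K / 2\<close>.\<close>
  define K where "K = 2 * ((L + 1) / \<kappa> + A + L\<^sub>0 + L * A)"
  have A: "\<bar>ctrl z \<theta> i\<bar> \<le> A" if "i \<in> {0, 1}" "\<theta> \<in> {0..1}" "\<bar>z\<bar> \<le> M" for z \<theta> i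
  proof -
    have "L * \<bar>\<theta>\<bar> + \<bar>z\<bar> \<le> L + \<bar>M\<bar>"
      using that L_nonneg by (intro add_mono) (auto intro: mult_left_le)
    hence "(L * \<bar>\<theta>\<bar> + \<bar>z\<bar>) / \<kappa> \<le> (L + \<bar>M\<bar>) / \<kappa>"
      using kappa_pos by (intro divide_right_mono) auto
    moreover have "ctrl 0 0 0 \<ge> 0" "ctrl 0 0 1 \<ge> 0"
      by (auto intro: opt_control_nonneg)
    ultimately show ?thesis
      using opt_control_lipschitz[OF that(1,2), of 0 z 0] that(1) opt_control_nonneg[OF that(1,2), of z]
      unfolding A_def by auto
  qed
  have "A \<ge> 0"
    unfolding A_def using opt_control_nonneg[of 0 0 0] opt_control_nonneg[of 1 0 0] L_nonneg kappa_pos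
    by simp
  have lip: "\<bar>ctrl p \<theta> i - ctrl q \<eta> i\<bar> \<le> (L + 1) / \<kappa> * (\<bar>\<theta> - \<eta>\<bar> + \<bar>p - q\<bar>)"
    if "i \<in> {0, 1}" "\<theta> \<in> {0..1}" "\<eta> \<in> {0..1}" for p q \<theta> \<eta> i
  proof -
    have "L * \<bar>\<theta> - \<eta>\<bar> + \<bar>p - q\<bar> \<le> (L + 1) * (\<bar>\<theta> - \<eta>\<bar> + \<bar>p - q\<bar>)"
      using L_nonneg by (simp add: algebra_simps)
    hence "(L * \<bar>\<theta> - \<eta>\<bar> + \<bar>p - q\<bar>) / \<kappa> \<le> (L + 1) * (\<bar>\<theta> - \<eta>\<bar> + \<bar>p - q\<bar>) / \<kappa>"
      using kappa_pos by (intro divide_right_mono) auto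
    with opt_control_lipschitz[OF that, of p q] show ?thesis by simp
  qed
  show thesis
  proof
    show "K \<ge> 0"
      using L_nonneg \<open>A \<ge> 0\<close> kappa_pos by (simp add: K_def)
    fix \<theta> \<eta> z w :: real
    assume *: "\<theta> \<in> {0..1}" "\<eta> \<in> {0..1}" "\<bar>z\<bar> \<le> M" "\<bar>w\<bar> \<le> M"
    let ?d = "\<bar>\<theta> - \<eta>\<bar> + \<bar>z - w\<bar>"
    \<comment> \<open>Changes of the controls carry weights in [0,1]; changes of the weights
      multiply controls bounded by \<open>A\<close>.\<close>
    have "flux \<theta> z - flux \<eta> w = (1 - \<theta>) * (ctrl (- z) \<theta> 1 - ctrl (- w) \<eta> 1)
        - \<theta> * (ctrl z \<theta> 0 - ctrl w \<eta> 0) - (\<theta> - \<eta>) * (ctrl (- w) \<eta> 1) - (\<theta> - \<eta>) * (ctrl w \<eta> 0)"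
      by (simp add: flux_def algebra_simps)
    hence "\<bar>flux \<theta> z - flux \<eta> w\<bar> \<le> \<bar>1 - \<theta>\<bar> * \<bar>ctrl (- z) \<theta> 1 - ctrl (- w) \<eta> 1\<bar>
        + \<bar>\<theta>\<bar> * \<bar>ctrl z \<theta> 0 - ctrl w \<eta> 0\<bar> + \<bar>\<theta> - \<eta>\<bar> * \<bar>ctrl (- w) \<eta> 1\<bar> + \<bar>\<theta> - \<eta>\<bar> * \<bar>ctrl w \<eta> 0\<bar>"
      unfolding abs_mult[symmetric] by linarith
    also have "\<dots> \<le> 1 * ((L + 1) / \<kappa> * ?d) + 1 * ((L + 1) / \<kappa> * ?d) + ?d * A + ?d * A"
      using * lip[of 1 \<theta> \<eta> "- z" "- w"] lip[of 0 \<theta> \<eta> z w] A[of 1 \<eta> "- w"] A[of 0 \<eta> w]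
      by (intro add_mono mult_mono) (auto simp: abs_minus_commute)
    also have "\<dots> = (2 * ((L + 1) / \<kappa> + A)) * ?d"
      by (simp add: distrib_left distrib_right mult.assoc)
    also have "\<dots> \<le> K * ?d"
      using L_nonneg \<open>A \<ge> 0\<close> by (intro mult_right_mono) (auto simp: K_def)
    finally show "\<bar>flux \<theta> z - flux \<eta> w\<bar> \<le> K * ?d" .
    have ham: "\<bar>h p \<theta> i - h q \<eta> i\<bar> \<le> K / 2 * (\<bar>\<theta> - \<eta>\<bar> + \<bar>p - q\<bar>)"
      if "i \<in> {0, 1}" "\<bar>p\<bar> \<le> M" "\<bar>q\<bar> \<le> M" for i p q
    proof -
      have "\<bar>h p \<theta> i - h q \<eta> i\<bar> \<le> (L\<^sub>0 + L * A) * \<bar>\<theta> - \<eta>\<bar> + A * \<bar>p - q\<bar>"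
        using that * A[of i \<theta> p] A[of i \<eta> q] by (intro hamiltonian_lipschitz) auto
      also have "\<dots> \<le> (L\<^sub>0 + L * A + A) * (\<bar>\<theta> - \<eta>\<bar> + \<bar>p - q\<bar>)"
        using L_nonneg \<open>A \<ge> 0\<close> by (simp add: distrib_left distrib_right)
      also have "\<dots> \<le> K / 2 * (\<bar>\<theta> - \<eta>\<bar> + \<bar>p - q\<bar>)"
        using L_nonneg kappa_pos by (intro mult_right_mono) (auto simp: K_def)
      finally show ?thesis .
    qed
    have "\<bar>gap_rate \<theta> z - gap_rate \<eta> w\<bar> \<le> \<bar>h z \<theta> 0 - h w \<eta> 0\<bar> + \<bar>h (- z) \<theta> 1 - h (- w) \<eta> 1\<bar>"
      unfolding gap_rate_def by linarith
    also have "\<dots> \<le> K * ?d"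
      using * ham[of 0 z w] ham[of 1 "- z" "- w"] by (simp add: abs_minus_commute)
    finally show "\<bar>gap_rate \<theta> z - gap_rate \<eta> w\<bar> \<le> K * ?d" .
    show "\<bar>h z \<theta> i - h w \<eta> i\<bar> \<le> K * ?d" if "i \<in> {0, 1}" for i
      by (rule order_trans[OF ham[OF that *(3,4)] mult_right_mono]) (use \<open>K \<ge> 0\<close> in auto)
  qed
qed

text \<open>Compactness bounds \<open>p\<close>, so the local Lipschitz estimate applies along the
  path. This makes the running Hamiltonian integrable when the values are recovered from the
  gap.\<close>

lemma continuous_on_hamiltonian:
  assumes i: "i \<in> {0, 1}" and "compact S" "continuous_on S p" "continuous_on S \<theta>" "\<theta> ` S \<subseteq> {0..1}"
  shows "continuous_on S (\<lambda>t. h (p t) (\<theta> t) i)"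
proof -
  have "bounded (p ` S)"
    using assms by (intro compact_imp_bounded compact_continuous_image)
  then obtain M where M: "\<bar>p t\<bar> \<le> M" if "t \<in> S" for t
    by (auto simp: bounded_iff)
  obtain K where K: "K \<ge> 0" "\<And>\<theta> \<eta> z w. \<theta> \<in> {0..1} \<Longrightarrow> \<eta> \<in> {0..1} \<Longrightarrow> \<bar>z\<bar> \<le> M \<Longrightarrow> \<bar>w\<bar> \<le> M \<Longrightarrow>
      \<bar>h z \<theta> i - h w \<eta> i\<bar> \<le> K * (\<bar>\<theta> - \<eta>\<bar> + \<bar>z - w\<bar>)"
    using locally_lipschitz i by metis
  have "(2 * K)-lipschitz_on ({-M..M} \<times> {0..1}) (\<lambda>x. h (fst x) (snd x) i)"
  proof (rule lipschitz_onI)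
    fix x y assume "x \<in> {-M..M} \<times> {0..1::real}" "y \<in> {-M..M} \<times> {0..1::real}"
    hence "dist (h (fst x) (snd x) i) (h (fst y) (snd y) i)
        \<le> K * (dist (snd x) (snd y) + dist (fst x) (fst y))"
      using K(2)[of "snd x" "snd y" "fst x" "fst y"] by (auto simp: dist_real_def)
    also have "\<dots> \<le> K * (dist x y + dist x y)"
      using K(1) by (intro mult_left_mono add_mono dist_fst_le dist_snd_le)
    finally show "dist (h (fst x) (snd x) i) (h (fst y) (snd y) i) \<le> 2 * K * dist x y"
      by simp
  qed (use K in simp)
  hence "continuous_on ({-M..M} \<times> {0..1}) (\<lambda>x. h (fst x) (snd x) i)"
    by (rule lipschitz_on_continuous_on)
  from continuous_on_compose2[OF this continuous_on_Pair[OF assms(3,4)]] show ?thesis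
    using M assms(5) by (fastforce simp: abs_le_iff)
qed

text \<open>The left side is the derivative of \<open>(\<theta> - \<eta>) * (w - z)\<close> along
  two trajectories. It is bounded by four supergradient inequalities, weighted by the masses of the
  two states; the right side is the expression of the monotonicity hypothesis with
  \<open>q = w\<close> and \<open>p = z\<close>.\<close>

lemma duality_pairing:
  assumes "\<theta> \<in> {0..1}" "\<eta> \<in> {0..1}"
  shows "(flux \<theta> z - flux \<eta> w) * (w - z) + (\<theta> - \<eta>) * (gap_rate \<eta> w - gap_rate \<theta> z)
    \<le> \<theta> * (h w \<eta> 0 - h w \<theta> 0) + \<eta> * (h z \<theta> 0 - h z \<eta> 0)
      + (1 - \<theta>) * (h (- w) \<eta> 1 - h (- w) \<theta> 1) + (1 - \<eta>) * (h (- z) \<theta> 1 - h (- z) \<eta> 1)"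
proof -
  have "\<theta> * h w \<theta> 0 \<le> \<theta> * (h z \<theta> 0 + ctrl z \<theta> 0 * (w - z))"
    "(1 - \<theta>) * h (- w) \<theta> 1 \<le> (1 - \<theta>) * (h (- z) \<theta> 1 + ctrl (- z) \<theta> 1 * (- w - - z))"
    "\<eta> * h z \<eta> 0 \<le> \<eta> * (h w \<eta> 0 + ctrl w \<eta> 0 * (z - w))"
    "(1 - \<eta>) * h (- z) \<eta> 1 \<le> (1 - \<eta>) * (h (- w) \<eta> 1 + ctrl (- w) \<eta> 1 * (- z - - w))"
    by (intro mult_left_mono hamiltonian_concave; use assms in simp)+
  thus ?thesis
    unfolding flux_def gap_rate_def by (simp add: algebra_simps)
qed

section \<open>Existence by truncation and shooting\<close>

lemma gap_problem_exists:
  fixes \<Psi> :: "real \<Rightarrow> real"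
  assumes T: "T > 0" and init: "\<theta>\<^sub>0 \<in> {0..1}" and \<Psi>: "continuous_on {0..1} \<Psi>"
  obtains \<theta> z where "\<And>t. t \<in> {0..T} \<Longrightarrow> \<theta> t \<in> {0..1}"
    and "\<And>t. t \<in> {0..T} \<Longrightarrow> (\<theta> has_real_derivative flux (\<theta> t) (z t)) (at t within {0..T})"
    and "\<And>t. t \<in> {0..T} \<Longrightarrow> (z has_real_derivative gap_rate (\<theta> t) (z t)) (at t within {0..T})"
    and "\<theta> 0 = \<theta>\<^sub>0" "z T = \<Psi> (\<theta> T)"
proof -
  obtain K\<^sub>0 where K\<^sub>0: "K\<^sub>0 \<ge> 0"
    "\<And>\<theta> \<eta>. \<theta> \<in> {0..1} \<Longrightarrow> \<eta> \<in> {0..1} \<Longrightarrow> \<bar>gap_rate \<theta> 0 - gap_rate \<eta> 0\<bar> \<le> K\<^sub>0 * \<bar>\<theta> - \<eta>\<bar>"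
    using locally_lipschitz[of 0] by (metis abs_zero add.right_neutral diff_self order_refl)
  \<comment> \<open>\<open>C\<close> bounds the rate at zero gap uniformly in theta; it will be the
    slope of the linear barrier for the gap.\<close>
  define C where "C = \<bar>gap_rate 0 0\<bar> + K\<^sub>0"
  have C: "C \<ge> 0" "\<bar>gap_rate \<theta> 0\<bar> \<le> C" if "\<theta> \<in> {0..1}" for \<theta>
    using K\<^sub>0(2)[of \<theta> 0] that mult_left_le[of "\<bar>\<theta>\<bar>" K\<^sub>0] K\<^sub>0(1) by (auto simp: C_def)
  have "bounded (\<Psi> ` {0..1})"
    using \<Psi> by (intro compact_imp_bounded compact_continuous_image) auto
  then obtain B where "\<forall>y\<in>\<Psi> ` {0..1}. norm y \<le> B"
    by (auto simp only: bounded_iff)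
  hence B: "\<bar>\<Psi> \<theta>\<bar> \<le> B" if "\<theta> \<in> {0..1}" for \<theta>
    using that by auto
  \<comment> \<open>The truncation level is the a priori bound itself: terminal size
    \<open>B\<close> plus backward growth at slope \<open>C\<close> over time
    \<open>T\<close>.\<close>
  define M where "M = B + C * T"
  have "B \<ge> 0" "C \<ge> 0"
    using B[of 0] C(1)[of 0] by auto
  hence "M \<ge> 0"
    using T by (simp add: M_def)
  obtain K where K: "K \<ge> 0"
    and K_flux: "\<And>\<theta> \<eta> z w. \<theta> \<in> {0..1} \<Longrightarrow> \<eta> \<in> {0..1} \<Longrightarrow> \<bar>z\<bar> \<le> M \<Longrightarrow> \<bar>w\<bar> \<le> M \<Longrightarrow>
      \<bar>flux \<theta> z - flux \<eta> w\<bar> \<le> K * (\<bar>\<theta> - \<eta>\<bar> + \<bar>z - w\<bar>)"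
    and K_gap: "\<And>\<theta> \<eta> z w. \<theta> \<in> {0..1} \<Longrightarrow> \<eta> \<in> {0..1} \<Longrightarrow> \<bar>z\<bar> \<le> M \<Longrightarrow> \<bar>w\<bar> \<le> M \<Longrightarrow>
      \<bar>gap_rate \<theta> z - gap_rate \<eta> w\<bar> \<le> K * (\<bar>\<theta> - \<eta>\<bar> + \<bar>z - w\<bar>)"
    using locally_lipschitz[of M] by metis
  \<comment> \<open>Nonexpansive projections onto [0,1] and [-M,M]; composing with them makes the
    field globally Lipschitz.\<close>
  define k :: "real \<Rightarrow> real" where "k x = max 0 (min 1 x)" for x
  define m where "m x = max (- M) (min M x)" for x
  have k: "k x \<in> {0..1}" "x \<in> {0..1} \<Longrightarrow> k x = x" "\<bar>k x - k y\<bar> \<le> \<bar>x - y\<bar>" for x y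
    by (auto simp: k_def)
  have m: "\<bar>m x\<bar> \<le> M" "\<bar>x\<bar> \<le> M \<Longrightarrow> m x = x" "\<bar>m x - m y\<bar> \<le> \<bar>x - y\<bar>" for x y
    using \<open>M \<ge> 0\<close> by (auto simp: m_def)
  define f where "f x = (flux (k (fst x)) (m (snd x)), gap_rate (k (fst x)) (m (snd x)))" for x
  have lip: "(4 * K)-lipschitz_on UNIV f"
  proof (rule lipschitz_onI)
    fix x y
    have "K * (\<bar>k (fst x) - k (fst y)\<bar> + \<bar>m (snd x) - m (snd y)\<bar>)
        \<le> K * (dist (fst x) (fst y) + dist (snd x) (snd y))"
      using K k(3) m(3) by (intro mult_left_mono add_mono) (auto simp: dist_real_def)
    also have "\<dots> \<le> K * (dist x y + dist x y)"
      using K by (intro mult_left_mono add_mono dist_fst_le dist_snd_le)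
    finally have *: "K * (\<bar>k (fst x) - k (fst y)\<bar> + \<bar>m (snd x) - m (snd y)\<bar>) \<le> 2 * K * dist x y"
      by simp
    have "dist (f x) (f y) \<le> dist (fst (f x)) (fst (f y)) + dist (snd (f x)) (snd (f y))"
      unfolding dist_prod_def by (rule sqrt_sum_squares_le_sum) auto
    also have "\<dots> \<le> 2 * K * dist x y + 2 * K * dist x y"
      unfolding f_def dist_real_def fst_conv snd_conv
      using k(1) m(1) by (intro add_mono order_trans[OF K_flux *] order_trans[OF K_gap *])
    finally show "dist (f x) (f y) \<le> 4 * K * dist x y" by simp
  qed (use K in simp)
  obtain \<Phi> where \<Phi>0: "\<And>x. \<Phi> x 0 = x"
    and \<Phi>: "\<And>x t. t \<in> {0..T} \<Longrightarrow> (\<Phi> x has_vector_derivative f (\<Phi> x t)) (at t within {0..T})"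
    and cont: "\<And>t. t \<in> {0..T} \<Longrightarrow> continuous_on UNIV (\<lambda>x. \<Phi> x t)"
    using lipschitz_flow_exists[OF lip less_imp_le[OF T]] by metis
  define \<theta> where "\<theta> s t = fst (\<Phi> (\<theta>\<^sub>0, s) t)" for s t
  define z where "z s t = snd (\<Phi> (\<theta>\<^sub>0, s) t)" for s t
  have d\<theta>: "(\<theta> s has_real_derivative flux (k (\<theta> s t)) (m (z s t))) (at t within {0..T})"
    and dz: "(z s has_real_derivative gap_rate (k (\<theta> s t)) (m (z s t))) (at t within {0..T})"
    if "t \<in> {0..T}" for s t
    using bounded_linear.has_vector_derivative[OF bounded_linear_fst \<Phi>[OF that, of "(\<theta>\<^sub>0, s)"]]
      bounded_linear.has_vector_derivative[OF bounded_linear_snd \<Phi>[OF that, of "(\<theta>\<^sub>0, s)"]]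
    by (simp_all add: has_real_derivative_iff_has_vector_derivative \<theta>_def[abs_def] z_def[abs_def] f_def)
  have start: "\<theta> s 0 = \<theta>\<^sub>0" "z s 0 = s" for s
    by (simp_all add: \<theta>_def z_def \<Phi>0)

  \<comment> \<open>The truncated rate is bounded by \<open>N\<close>, so the gap moves at most
    \<open>N * T\<close> away from its initial value \<open>s\<close>.\<close>
  define N where "N = \<bar>gap_rate 0 0\<bar> + K * (1 + M)"
  have "\<bar>gap_rate (k x) (m y)\<bar> \<le> N" for x y
  proof -
    have "\<bar>gap_rate (k x) (m y) - gap_rate 0 0\<bar> \<le> K * (\<bar>k x - 0\<bar> + \<bar>m y - 0\<bar>)"
      using k(1) m(1) \<open>M \<ge> 0\<close> by (intro K_gap) auto
    also have "\<dots> \<le> K * (1 + M)"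
      using K k(1)[of x] m(1)[of y] by (intro mult_left_mono) auto
    finally show ?thesis by (simp add: N_def)
  qed
  hence "norm (z s T - z s 0) \<le> N * norm (T - 0)" for s
    using T by (intro field_differentiable_bound[OF _ dz[of _ s]]) auto
  hence shot: "\<bar>z s T - s\<bar> \<le> N * T" for s
    using T start(2)[of s] by (metis abs_of_pos diff_zero real_norm_def)
  \<comment> \<open>Terminal miss of the shot from \<open>s\<close>. The projection \<open>k\<close>
    is needed because theta is not yet known to stay in [0,1]. Starting at
    \<open>- B - N * T\<close> or \<open>B + N * T\<close>, the gap ends below \<open>- B\<close> or
    above \<open>B\<close>, so the miss changes sign.\<close>
  define S where "S s = z s T - \<Psi> (k (\<theta> s T))" for s
  have "continuous_on UNIV (\<lambda>s. \<Phi> (\<theta>\<^sub>0, s) T)"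
    by (rule continuous_on_compose2[OF cont[of T]]) (use T in \<open>auto intro!: continuous_intros\<close>)
  hence "continuous_on UNIV S"
    unfolding S_def \<theta>_def z_def k_def
    by (intro continuous_intros continuous_on_compose2[OF \<Psi>]) auto
  hence "continuous_on {- B - N * T..B + N * T} S"
    by (rule continuous_on_subset) auto
  moreover have "S (- B - N * T) \<le> 0" "0 \<le> S (B + N * T)"
    using shot[of "- B - N * T"] shot[of "B + N * T"]
      B[OF k(1), of "\<theta> (- B - N * T) T"] B[OF k(1), of "\<theta> (B + N * T) T"]
    by (auto simp: S_def abs_le_iff)
  moreover have "- B - N * T \<le> B + N * T"
    using \<open>B \<ge> 0\<close> T shot[of 0] by linarith
  ultimately obtain s where "S s = 0"
    using IVT'[of S "- B - N * T" 0 "B + N * T"] by auto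
  hence zT: "z s T = \<Psi> (k (\<theta> s T))"
    by (simp add: S_def)

  \<comment> \<open>Outside [0,1] the projection holds the distribution at an endpoint, where the
    flux points inward: state 0 can only gain mass at 0 and only lose it at 1.\<close>
  have \<theta>_range: "\<theta> s t \<in> {0..1}" if t: "t \<in> {0..T}" for t
  proof -
    have "- \<theta> s t \<le> 0"
    proof (rule nonpos_invariant_forward[OF DERIV_minus[OF d\<theta>] _ _ t])
      fix t assume "0 < - \<theta> s t"
      hence "k (\<theta> s t) = 0" by (simp add: k_def)
      thus "- flux (k (\<theta> s t)) (m (z s t)) \<le> 0"
        using opt_control_nonneg[of 1 0] by (simp add: flux_def)
    qed (use start init in auto)
    moreover have "\<theta> s t - 1 \<le> 0"
    proof (rule nonpos_invariant_forward[OF _ _ _ t])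
      show "((\<lambda>t. \<theta> s t - 1) has_real_derivative flux (k (\<theta> s t)) (m (z s t))) (at t within {0..T})"
        if "t \<in> {0..T}" for t
        using d\<theta>[OF that] by (auto intro!: derivative_eq_intros)
      fix t assume "0 < \<theta> s t - 1"
      hence "k (\<theta> s t) = 1" by (simp add: k_def)
      thus "flux (k (\<theta> s t)) (m (z s t)) \<le> 0"
        using opt_control_nonneg[of 0 1] by (simp add: flux_def)
    qed (use start init in auto)
    ultimately show ?thesis by simp
  qed
  have z_range: "\<bar>z s t\<bar> \<le> M" if t: "t \<in> {0..T}" for t
  proof -
    have B': "\<bar>z s T\<bar> \<le> B"
      using B[OF k(1), of "\<theta> s T"] zT by simp
    \<comment> \<open>Above the barrier the gap is nonnegative, and so is its truncation;
      monotonicity then bounds the rate below by its value at zero gap, hence by \<open>- C\<close>.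
      The lower barrier is symmetric.\<close>
    have "z s t - B - C * (T - t) \<le> 0"
    proof (rule nonpos_invariant_backward[OF _ _ _ t])
      show "((\<lambda>t. z s t - B - C * (T - t)) has_real_derivative gap_rate (k (\<theta> s t)) (m (z s t)) + C)
          (at t within {0..T})" if "t \<in> {0..T}" for t
        using dz[OF that] by (auto intro!: derivative_eq_intros)
      fix r assume r: "r \<in> {0..T}" "0 < z s r - B - C * (T - r)"
      hence "0 \<le> C * (T - r)"
        using \<open>C \<ge> 0\<close> by simp
      hence "m (z s r) \<ge> 0"
        using r \<open>B \<ge> 0\<close> \<open>M \<ge> 0\<close> by (simp add: m_def)
      from gap_rate_mono[OF k(1) this, of "\<theta> s r"] C(2)[OF k(1), of "\<theta> s r"]
      show "0 \<le> gap_rate (k (\<theta> s r)) (m (z s r)) + C" by linarith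
    qed (use B' in auto)
    moreover have "- z s t - B - C * (T - t) \<le> 0"
    proof (rule nonpos_invariant_backward[OF _ _ _ t])
      show "((\<lambda>t. - z s t - B - C * (T - t)) has_real_derivative - gap_rate (k (\<theta> s t)) (m (z s t)) + C)
          (at t within {0..T})" if "t \<in> {0..T}" for t
        using dz[OF that] by (auto intro!: derivative_eq_intros)
      fix r assume r: "r \<in> {0..T}" "0 < - z s r - B - C * (T - r)"
      hence "0 \<le> C * (T - r)"
        using \<open>C \<ge> 0\<close> by simp
      hence "m (z s r) \<le> 0"
        using r \<open>B \<ge> 0\<close> \<open>M \<ge> 0\<close> by (simp add: m_def)
      from gap_rate_mono[OF k(1) this, of "\<theta> s r"] C(2)[OF k(1), of "\<theta> s r"]
      show "0 \<le> - gap_rate (k (\<theta> s r)) (m (z s r)) + C" by linarith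
    qed (use B' in auto)
    moreover have "C * (T - t) \<le> C * T"
      using t \<open>C \<ge> 0\<close> by (intro mult_left_mono) auto
    ultimately show ?thesis by (simp add: M_def abs_le_iff)
  qed
  show thesis
  proof
    show "\<theta> s t \<in> {0..1}" if "t \<in> {0..T}" for t
      using \<theta>_range[OF that] .
    show "(\<theta> s has_real_derivative flux (\<theta> s t) (z s t)) (at t within {0..T})"
      and "(z s has_real_derivative gap_rate (\<theta> s t) (z s t)) (at t within {0..T})"
      if "t \<in> {0..T}" for t
      using d\<theta>[OF that, of s] dz[OF that, of s] \<theta>_range[OF that] z_range[OF that]
      by (simp_all add: k(2) m(2))
    show "z s T = \<Psi> (\<theta> s T)"
      using zT \<theta>_range[of T] T by (simp add: k(2))
  qed (rule start)
qed

lemma mfg_solution_iff: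
  "mfg_solution c \<psi> T \<theta>\<^sub>0 \<theta> u \<longleftrightarrow>
    (\<forall>t\<in>{0..T}. \<theta> t \<in> {0..1}
      \<and> (\<theta> has_real_derivative flux (\<theta> t) (u 1 t - u 0 t)) (at t within {0..T})
      \<and> (u 0 has_real_derivative - h (u 1 t - u 0 t) (\<theta> t) 0) (at t within {0..T})
      \<and> (u 1 has_real_derivative - h (- (u 1 t - u 0 t)) (\<theta> t) 1) (at t within {0..T}))
    \<and> \<theta> 0 = \<theta>\<^sub>0 \<and> u 0 T = \<psi> 0 (\<theta> T) \<and> u 1 T = \<psi> 1 (\<theta> T)"
  unfolding mfg_solution_def flux_def by auto

text \<open>Once distribution and gap are known, each equation for \<open>u i\<close> has a known
  right side and is solved by integration, normalized at \<open>T\<close>.\<close>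

lemma mfg_solution_exists:
  assumes T: "T > 0" and init: "\<theta>\<^sub>0 \<in> {0..1}"
    and \<psi>: "\<And>i. i \<in> {0, 1} \<Longrightarrow> continuous_on {0..1} (\<psi> i)"
  obtains \<theta> u where "mfg_solution c \<psi> T \<theta>\<^sub>0 \<theta> u"
proof -
  obtain \<theta> z where \<theta>: "\<And>t. t \<in> {0..T} \<Longrightarrow> \<theta> t \<in> {0..1}"
    and d\<theta>: "\<And>t. t \<in> {0..T} \<Longrightarrow> (\<theta> has_real_derivative flux (\<theta> t) (z t)) (at t within {0..T})"
    and dz: "\<And>t. t \<in> {0..T} \<Longrightarrow> (z has_real_derivative gap_rate (\<theta> t) (z t)) (at t within {0..T})"
    and bc: "\<theta> 0 = \<theta>\<^sub>0" "z T = \<psi> 1 (\<theta> T) - \<psi> 0 (\<theta> T)"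
    using gap_problem_exists[OF T init continuous_on_diff[OF \<psi>[of 1] \<psi>[of 0]]] by auto
  define p where "p i t = (if i = 0 then z t else - z t)" for i :: nat and t
  define I where "I i t = integral {0..t} (\<lambda>s. h (p i s) (\<theta> s) i)" for i t
  define u where "u i t = \<psi> i (\<theta> T) + I i T - I i t" for i t
  have du: "(u i has_real_derivative - h (p i t) (\<theta> t) i) (at t within {0..T})"
    if "i \<in> {0, 1}" "t \<in> {0..T}" for i t
  proof -
    have "continuous_on {0..T} z" "continuous_on {0..T} \<theta>"
      using dz d\<theta> DERIV_continuous by (fastforce simp: continuous_on_eq_continuous_within)+
    hence "continuous_on {0..T} (\<lambda>s. h (p i s) (\<theta> s) i)"
      using that \<theta> by (intro continuous_on_hamiltonian) (auto simp: p_def intro!: continuous_intros)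
    hence "(I i has_real_derivative h (p i t) (\<theta> t) i) (at t within {0..T})"
      using that unfolding I_def has_real_derivative_iff_has_vector_derivative
      by (intro integral_has_vector_derivative)
    thus ?thesis
      unfolding u_def by (auto intro!: derivative_eq_intros)
  qed
  have uT: "u i T = \<psi> i (\<theta> T)" for i
    by (simp add: u_def)
  \<comment> \<open>Consistency: the difference of the constructed values has the same derivative
    and terminal value as the gap it was built from.\<close>
  have "u 1 t - u 0 t - z t = 0" if "t \<in> {0..T}" for t
  proof (rule deriv_within_zero_imp_zero[OF _ _ that])
    fix t assume t: "t \<in> {0..T}"
    show "((\<lambda>t. u 1 t - u 0 t - z t) has_real_derivative 0) (at t within {0..T})"
      using DERIV_diff[OF DERIV_diff[OF du[of 1 t] du[of 0 t]] dz[OF t]] t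
      by (simp add: p_def gap_rate_def)
  qed (use uT bc in auto)
  hence gap: "u 1 t - u 0 t = z t" if "t \<in> {0..T}" for t
    using that by simp
  have "mfg_solution c \<psi> T \<theta>\<^sub>0 \<theta> u"
    unfolding mfg_solution_iff
    using \<theta> d\<theta> du[of 0] du[of 1] bc uT by (auto simp: p_def gap[unfolded One_nat_def])
  thus thesis ..
qed

section \<open>Uniqueness by the duality pairing\<close>

lemma mfg_solution_unique:
  assumes T: "T > 0" and "\<gamma> > 0"
    and psi_monotone: "\<And>x y. x \<in> {0..1} \<Longrightarrow> y \<in> {0..1} \<Longrightarrow>
        (x - y) * (\<psi> 0 x - \<psi> 0 y) + (y - x) * (\<psi> 1 x - \<psi> 1 y) \<ge> 0"
    and h_monotone: "\<And>p q \<theta> \<eta>. \<theta> \<in> {0..1} \<Longrightarrow> \<eta> \<in> {0..1} \<Longrightarrow>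
        \<theta> * (h q \<eta> 0 - h q \<theta> 0) + \<eta> * (h p \<theta> 0 - h p \<eta> 0)
        + (1 - \<theta>) * (h (- q) \<eta> 1 - h (- q) \<theta> 1) + (1 - \<eta>) * (h (- p) \<theta> 1 - h (- p) \<eta> 1)
        \<le> - \<gamma> * \<bar>\<theta> - \<eta>\<bar>\<^sup>2"
    and sol: "mfg_solution c \<psi> T \<theta>\<^sub>0 \<theta> u" "mfg_solution c \<psi> T \<theta>\<^sub>0 \<eta> v"
    and t: "t \<in> {0..T}" and i: "i \<in> {0, 1}"
  shows "\<eta> t = \<theta> t" "v i t = u i t"
proof -
  note sol1 = sol(1)[unfolded mfg_solution_iff]
  note sol2 = sol(2)[unfolded mfg_solution_iff]
  define z where "z t = u 1 t - u 0 t" for t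
  define w where "w t = v 1 t - v 0 t" for t
  have dz: "(z has_real_derivative gap_rate (\<theta> t) (z t)) (at t within {0..T})"
    and dw: "(w has_real_derivative gap_rate (\<eta> t) (w t)) (at t within {0..T})"
    if "t \<in> {0..T}" for t
    unfolding z_def[abs_def] w_def[abs_def] gap_rate_def
    using that sol1 sol2 by (auto intro!: derivative_eq_intros)
  define D where "D t = (\<theta> t - \<eta> t) * (w t - z t)" for t
  define D' where "D' t = (flux (\<theta> t) (z t) - flux (\<eta> t) (w t)) * (w t - z t)
      + (\<theta> t - \<eta> t) * (gap_rate (\<eta> t) (w t) - gap_rate (\<theta> t) (z t))" for t
  have D: "(D has_real_derivative D' t) (at t within {0..T})" if "t \<in> {0..T}" for t
  proof -
    have "(\<theta> has_real_derivative flux (\<theta> t) (z t)) (at t within {0..T})"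
      "(\<eta> has_real_derivative flux (\<eta> t) (w t)) (at t within {0..T})"
      using that sol1 sol2 by (auto simp: z_def w_def)
    from DERIV_mult[OF DERIV_diff[OF this] DERIV_diff[OF dw dz], OF that that]
    show ?thesis
      unfolding D_def[abs_def] D'_def by (simp add: algebra_simps)
  qed
  have D': "D' t \<le> - \<gamma> * \<bar>\<theta> t - \<eta> t\<bar>\<^sup>2" if "t \<in> {0..T}" for t
    using duality_pairing[of "\<theta> t" "\<eta> t" "z t" "w t"] h_monotone[of "\<theta> t" "\<eta> t" "w t" "z t"]
      that sol1 sol2 unfolding D'_def by fastforce
  have anti: "D b \<le> D a" if "0 \<le> a" "a \<le> b" "b \<le> T" for a b
  proof -
    have "- D a \<le> - D b"
    proof (rule mono_of_deriv_within_nonneg[where f = "\<lambda>t. - D t" and f' = "\<lambda>t. - D' t"])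
      fix r assume "r \<in> {a..b}"
      thus "((\<lambda>t. - D t) has_real_derivative - D' r) (at r within {a..b})"
        using that by (intro DERIV_minus DERIV_subset[OF D]) auto
    next
      fix r assume "r \<in> {a<..<b}"
      moreover have "0 \<le> \<gamma> * \<bar>\<theta> r - \<eta> r\<bar>\<^sup>2"
        using \<open>\<gamma> > 0\<close> by simp
      ultimately show "0 \<le> - D' r"
        using D'[of r] that by auto
    qed fact
    thus ?thesis by simp
  qed
  have "D 0 = 0"
    using sol1 sol2 by (simp add: D_def)
  \<comment> \<open>After inserting the terminal conditions this is the monotonicity hypothesis on
    \<open>\<psi>\<close>.\<close>
  moreover have "D T \<ge> 0"
    using psi_monotone[of "\<theta> T" "\<eta> T"] sol1 sol2 T by (simp add: D_def z_def w_def algebra_simps)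
  \<comment> \<open>\<open>D\<close> is nonincreasing, starts at 0 and ends nonnegative, so it
    vanishes throughout.\<close>
  ultimately have D0: "D t = 0" if "t \<in> {0..T}" for t
    using anti[of 0 t] anti[of t T] that by auto
  have eq: "\<eta> t = \<theta> t" if t: "t \<in> {0..T}" for t
  proof -
    \<comment> \<open>The derivative within the interval vanishes at the endpoints too, so the
      strict \<open>\<gamma>\<close> term forces equality at every time.\<close>
    have "(D has_vector_derivative 0) (at t within {0..T})"
      by (rule has_vector_derivative_transform[OF t _ has_vector_derivative_const[of 0]])
        (use D0 in auto)
    hence "D' t = 0"
      using D[OF t] vector_derivative_unique_within_closed_interval[OF T, of t D "D' t" 0] t
      by (simp add: has_real_derivative_iff_has_vector_derivative box_real)
    with D'[OF t] \<open>\<gamma> > 0\<close> show ?thesis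
      by (simp add: mult_le_0_iff)
  qed
  have gap: "w t = z t" if t: "t \<in> {0..T}" for t
  proof -
    \<comment> \<open>The distributions now agree, so the gaps solve the same equation with rate
      nondecreasing in the gap: their squared distance can only grow towards \<open>T\<close>, where
      it is 0.\<close>
    have "(w t - z t)\<^sup>2 \<le> (w T - z T)\<^sup>2"
    proof (rule mono_of_deriv_within_nonneg[where f = "\<lambda>t. (w t - z t)\<^sup>2"
          and f' = "\<lambda>r. 2 * ((w r - z r) * (gap_rate (\<theta> r) (w r) - gap_rate (\<theta> r) (z r)))"])
      fix r assume r: "r \<in> {t..T}"
      hence r': "r \<in> {0..T}" using t by auto
      have "((\<lambda>t. (w t - z t)\<^sup>2) has_real_derivative
          2 * ((w r - z r) * (gap_rate (\<theta> r) (w r) - gap_rate (\<theta> r) (z r)))) (at r within {0..T})"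
        using dz[OF r'] dw[OF r'] eq[OF r'] by (auto intro!: derivative_eq_intros)
      thus "((\<lambda>t. (w t - z t)\<^sup>2) has_real_derivative
          2 * ((w r - z r) * (gap_rate (\<theta> r) (w r) - gap_rate (\<theta> r) (z r)))) (at r within {t..T})"
        by (rule DERIV_subset) (use t in auto)
    next
      fix r assume "r \<in> {t<..<T}"
      hence "\<theta> r \<in> {0..1}" using t sol1 by auto
      thus "0 \<le> 2 * ((w r - z r) * (gap_rate (\<theta> r) (w r) - gap_rate (\<theta> r) (z r)))"
        using gap_rate_mono[of "\<theta> r" "w r" "z r"] gap_rate_mono[of "\<theta> r" "z r" "w r"]
        by (cases "w r \<le> z r") (auto simp: mult_nonpos_nonpos)
    qed (use t in auto)
    moreover have "w T = z T"
      using sol1 sol2 eq[of T] T by (simp add: z_def w_def)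
    ultimately show ?thesis by simp
  qed
  show "\<eta> t = \<theta> t" using eq[OF t] .
  \<comment> \<open>With equal distributions and gaps, both values have the same derivative and the
    same terminal value.\<close>
  have "v i t - u i t = 0"
  proof (rule deriv_within_zero_imp_zero[OF _ _ t])
    fix r assume r: "r \<in> {0..T}"
    have gap': "h (v 0 r - v 1 r) (\<theta> r) 1 = h (u 0 r - u 1 r) (\<theta> r) 1"
      using gap[OF r] by (intro arg_cong[where f = "\<lambda>p. h p _ _"]) (simp add: z_def w_def)
    consider "i = 0" | "i = 1" using i by auto
    thus "((\<lambda>t. v i t - u i t) has_real_derivative 0) (at r within {0..T})"
      using sol1 sol2 r gap[OF r] eq[OF r] gap'
      by cases (auto intro!: derivative_eq_intros simp: z_def w_def)
  qed (use sol1 sol2 eq[of T] T i in auto)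
  thus "v i t = u i t" by simp
qed

end

section \<open>The initial-terminal value problem under the standing assumptions\<close>

theorem theorem3:
  fixes c c' :: "nat \<Rightarrow> real \<Rightarrow> real \<Rightarrow> real" and \<psi> :: "nat \<Rightarrow> real \<Rightarrow> real"
    and T \<theta>\<^sub>0 \<kappa> \<gamma> :: real
  assumes T_pos: "T > 0"
    and init: "\<theta>\<^sub>0 \<in> {0..1}"
    and c_nonneg: "\<And>i \<theta> \<alpha>. i \<in> {0, 1} \<Longrightarrow> \<theta> \<in> {0..1} \<Longrightarrow> \<alpha> \<ge> 0 \<Longrightarrow> c i \<theta> \<alpha> \<ge> 0"
    and psi_nonneg: "\<And>i \<theta>. i \<in> {0, 1} \<Longrightarrow> \<theta> \<in> {0..1} \<Longrightarrow> \<psi> i \<theta> \<ge> 0"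
    and c_lipschitz: "\<And>i \<alpha>. i \<in> {0, 1} \<Longrightarrow> \<alpha> \<ge> 0 \<Longrightarrow> \<exists>L. L-lipschitz_on {0..1} (\<lambda>\<theta>. c i \<theta> \<alpha>)"
    and psi_lipschitz: "\<And>i. i \<in> {0, 1} \<Longrightarrow> \<exists>L. L-lipschitz_on {0..1} (\<psi> i)"
    and c_deriv: "\<And>i \<theta> \<alpha>. i \<in> {0, 1} \<Longrightarrow> \<theta> \<in> {0..1} \<Longrightarrow> \<alpha> \<ge> 0 \<Longrightarrow>
        (c i \<theta> has_real_derivative c' i \<theta> \<alpha>) (at \<alpha> within {0..})"
    and c'_lipschitz: "\<exists>L. \<forall>i\<in>{0, 1}. \<forall>\<alpha>\<ge>0. L-lipschitz_on {0..1} (\<lambda>\<theta>. c' i \<theta> \<alpha>)"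
    and kappa_pos: "\<kappa> > 0"
    and c_unif_convex: "\<And>i \<theta> \<alpha> \<alpha>'. i \<in> {0, 1} \<Longrightarrow> \<theta> \<in> {0..1} \<Longrightarrow> \<alpha> \<ge> 0 \<Longrightarrow> \<alpha>' \<ge> 0 \<Longrightarrow>
        c i \<theta> \<alpha>' \<ge> c i \<theta> \<alpha> + c' i \<theta> \<alpha> * (\<alpha>' - \<alpha>) + \<kappa> * \<bar>\<alpha>' - \<alpha>\<bar>\<^sup>2"
    and c_superlinear: "\<And>i \<theta>. i \<in> {0, 1} \<Longrightarrow> \<theta> \<in> {0..1} \<Longrightarrow>
        filterlim (\<lambda>\<alpha>. c i \<theta> \<alpha> / \<alpha>) at_top at_top"
    and psi_monotone: "\<And>x y. x \<in> {0..1} \<Longrightarrow> y \<in> {0..1} \<Longrightarrow>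
        (x - y) * (\<psi> 0 x - \<psi> 0 y) + (y - x) * (\<psi> 1 x - \<psi> 1 y) \<ge> 0"
    and gamma_pos: "\<gamma> > 0"
    and h_monotone: "\<And>p q \<theta> \<eta>. \<theta> \<in> {0..1} \<Longrightarrow> \<eta> \<in> {0..1} \<Longrightarrow>
        \<theta> * (hamiltonian c q \<eta> 0 - hamiltonian c q \<theta> 0)
        + \<eta> * (hamiltonian c p \<theta> 0 - hamiltonian c p \<eta> 0)
        + (1 - \<theta>) * (hamiltonian c (- q) \<eta> 1 - hamiltonian c (- q) \<theta> 1)
        + (1 - \<eta>) * (hamiltonian c (- p) \<theta> 1 - hamiltonian c (- p) \<eta> 1)
        \<le> - \<gamma> * \<bar>\<theta> - \<eta>\<bar>\<^sup>2"
  shows "\<exists>\<theta> u. mfg_solution c \<psi> T \<theta>\<^sub>0 \<theta> u \<and>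
    (\<forall>\<theta>' u'. mfg_solution c \<psi> T \<theta>\<^sub>0 \<theta>' u' \<longrightarrow>
       (\<forall>t\<in>{0..T}. \<theta>' t = \<theta> t \<and> (\<forall>i\<in>{0, 1}. u' i t = u i t)))"
proof -
  obtain L where L: "\<And>i \<alpha>. i \<in> {0, 1} \<Longrightarrow> \<alpha> \<ge> 0 \<Longrightarrow> L-lipschitz_on {0..1} (\<lambda>\<theta>. c' i \<theta> \<alpha>)"
    using c'_lipschitz by blast
  obtain L\<^sub>1 L\<^sub>2 where "L\<^sub>1-lipschitz_on {0..1} (\<lambda>\<theta>. c 0 \<theta> 0)" "L\<^sub>2-lipschitz_on {0..1} (\<lambda>\<theta>. c 1 \<theta> 0)"
    using c_lipschitz[of 0 0] c_lipschitz[of 1 0] by auto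
  \<comment> \<open>The larger constant serves both states at control 0.\<close>
  hence L\<^sub>0: "(max L\<^sub>1 L\<^sub>2)-lipschitz_on {0..1} (\<lambda>\<theta>. c i \<theta> 0)" if "i \<in> {0, 1}" for i
    using that by (auto intro: lipschitz_on_le)
  interpret two_state_cost c c' \<kappa> L "max L\<^sub>1 L\<^sub>2"
    by standard (fact kappa_pos c_deriv c_unif_convex L L\<^sub>0)+
  have "continuous_on {0..1} (\<psi> i)" if "i \<in> {0, 1}" for i
    using psi_lipschitz[OF that] lipschitz_on_continuous_on by blast
  then obtain \<theta> u where sol: "mfg_solution c \<psi> T \<theta>\<^sub>0 \<theta> u"
    using mfg_solution_exists[OF T_pos init] by blast
  show ?thesis
    using sol mfg_solution_unique[OF T_pos gamma_pos psi_monotone h_monotone sol] by blast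
qed

end
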